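(* Every regular tubular surface in Euclidean $3$-space is a linear Weingarten surface. More precisely, if $r>0$ is its radius, its Gaussian curvature $K$ and mean curvature $H$ satisfy $$Kr^2-2rH+1=0.$$
   Context: A surface is a linear Weingarten surface if its Gaussian curvature $K$ and mean curvature $H$ satisfy a nontrivial linear relation $aK+bH+c\equiv0$ with real constants $a,b,c$, $(a,b)\ne(0,0)$. Let $\gamma:(a,b)\to\mathbb{E}^3$ be a smooth curve with nonzero tangent vectors (the central curve) and let $r>0$. The tubular surface of radius $r$ around $\gamma$ is the union of all circles of radius $r$ and center $\gamma(s)$ contained in the planes through $\gamma(s)$ normal to $\gamma'(s)$, $s\in(a,b)$; it is parametrized by the pairs $(s,v)$ with $v$ a unit vector orthogonal to $\gamma'(s)$, via $(s,v)\mapsto\gamma(s)+rv$. It is called regular if $\gamma$ is parametrized by arc length and $1-r\kappa(s)\cos t\neq0$ for all $(s,t)\in(a,b)\times\mathbb{R}$, where $\kappa=\|\gamma''\|$; the parametrization is then an immersion, and $K$ and $H$ are the Gaussian and mean curvatures of this immersed surface, where $H$ is half the sum of the principal curvatures, computed with the unit normal $-v$ at the point $(s,v)$ (pointing toward the central curve; so a cylinder of radius $r$ has $K=0$, $H=\frac1{2r}$). *)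

theory Defs
  imports "HOL-Analysis.Analysis"
begin

text \<open>A surface is given by a parameter manifold \<open>M\<close>, embedded in a Euclidean space, together with an
  immersion \<open>f\<close> of \<open>M\<close> into \<open>real^3\<close> and a unit normal field \<open>N\<close> along \<open>f\<close>. Both \<open>f\<close> and \<open>N\<close> are
  total functions, of which only the restriction to \<open>M\<close> matters.\<close>

definition tangent_space :: "'a::euclidean_space set \<Rightarrow> 'a \<Rightarrow> 'a set" where
  "tangent_space M p =
     {w. \<exists>c :: real \<Rightarrow> 'a. c 0 = p \<and> (\<forall>\<^sub>F \<tau> in nhds 0. c \<tau> \<in> M)
           \<and> (c has_vector_derivative w) (at 0)}"

text \<open>The derivatives \<open>f'\<close> and \<open>N'\<close> within \<open>M\<close> are only determined on the tangent space, which is the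
  only place where they are used. The shape operator \<open>S\<close>, defined by \<open>f' (S w) = - N' w\<close>, has the
  basis \<open>w1\<close>, \<open>w2\<close> of eigenvectors with eigenvalues \<open>k1\<close>, \<open>k2\<close>; umbilic points, where \<open>k1 = k2\<close>, are
  included. The definition requires that, at \<open>p\<close>, \<open>M\<close> is two-dimensional, \<open>f\<close> is immersive and \<open>N\<close> is
  a unit normal.\<close>

definition principal_curvatures ::
  "'a::euclidean_space set \<Rightarrow> ('a \<Rightarrow> real^3) \<Rightarrow> ('a \<Rightarrow> real^3) \<Rightarrow> 'a \<Rightarrow> real \<Rightarrow> real \<Rightarrow> bool" where
  "principal_curvatures M f N p k1 k2 \<longleftrightarrow>
     (\<exists>f' N' w1 w2.
        (f has_derivative f') (at p within M) \<and> (N has_derivative N') (at p within M) \<and>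
        w1 \<noteq> w2 \<and> independent {w1, w2} \<and> tangent_space M p = span {w1, w2} \<and>
        inj_on f' (tangent_space M p) \<and>
        norm (N p) = 1 \<and> (\<forall>w\<in>tangent_space M p. N p \<bullet> f' w = 0) \<and>
        - N' w1 = k1 *\<^sub>R f' w1 \<and> - N' w2 = k2 *\<^sub>R f' w2)"

definition gauss_curvature ::
  "'a::euclidean_space set \<Rightarrow> ('a \<Rightarrow> real^3) \<Rightarrow> ('a \<Rightarrow> real^3) \<Rightarrow> 'a \<Rightarrow> real" where
  "gauss_curvature M f N p =
     (THE K. \<exists>k1 k2. principal_curvatures M f N p k1 k2 \<and> K = k1 * k2)"

definition mean_curvature ::
  "'a::euclidean_space set \<Rightarrow> ('a \<Rightarrow> real^3) \<Rightarrow> ('a \<Rightarrow> real^3) \<Rightarrow> 'a \<Rightarrow> real" where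
  "mean_curvature M f N p =
     (THE H. \<exists>k1 k2. principal_curvatures M f N p k1 k2 \<and> H = (k1 + k2) / 2)"

definition linear_weingarten ::
  "'a::euclidean_space set \<Rightarrow> ('a \<Rightarrow> real^3) \<Rightarrow> ('a \<Rightarrow> real^3) \<Rightarrow> bool" where
  "linear_weingarten M f N \<longleftrightarrow>
     (\<exists>a b c :: real. (a, b) \<noteq> (0, 0) \<and>
        (\<forall>p\<in>M. a * gauss_curvature M f N p + b * mean_curvature M f N p + c = 0))"

definition curve_deriv :: "(real \<Rightarrow> 'a::real_normed_vector) \<Rightarrow> real \<Rightarrow> 'a" where
  "curve_deriv \<gamma> s = vector_derivative \<gamma> (at s)"

text \<open>This is meant for open \<open>I\<close>.\<close>

definition smooth_curve_on :: "real set \<Rightarrow> (real \<Rightarrow> 'a::real_normed_vector) \<Rightarrow> bool" where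
  "smooth_curve_on I \<gamma> \<longleftrightarrow> (\<forall>n. \<forall>s\<in>I. (curve_deriv ^^ n) \<gamma> differentiable (at s))"

definition tube_domain :: "real set \<Rightarrow> (real \<Rightarrow> real^3) \<Rightarrow> (real \<times> (real^3)) set" where
  "tube_domain I \<gamma> = {(s, v). s \<in> I \<and> norm v = 1 \<and> v \<bullet> curve_deriv \<gamma> s = 0}"

definition tube_map :: "(real \<Rightarrow> real^3) \<Rightarrow> real \<Rightarrow> real \<times> (real^3) \<Rightarrow> real^3" where
  "tube_map \<gamma> r = (\<lambda>(s, v). \<gamma> s + r *\<^sub>R v)"

text \<open>The normal points toward the central curve, so that a cylinder of radius \<open>r\<close> has \<open>H = 1 / (2 * r)\<close>.\<close>

definition tube_normal :: "real \<times> (real^3) \<Rightarrow> real^3" where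
  "tube_normal = (\<lambda>(s, v). - v)"

text \<open>For a curve parametrized by arc length, \<open>norm (curve_deriv (curve_deriv \<gamma>) s)\<close> is its curvature.\<close>

definition regular_tube :: "real set \<Rightarrow> (real \<Rightarrow> real^3) \<Rightarrow> real \<Rightarrow> bool" where
  "regular_tube I \<gamma> r \<longleftrightarrow>
     (\<forall>s\<in>I. norm (curve_deriv \<gamma> s) = 1) \<and>
     (\<forall>s\<in>I. \<forall>t::real. 1 - r * norm (curve_deriv (curve_deriv \<gamma>) s) * cos t \<noteq> 0)"

end

theory Submission
  imports Defs
begin

text \<open>At \<open>(s, v)\<close> put \<open>T = \<gamma>' s\<close>, \<open>e = T \<times> v\<close> and \<open>m = v \<bullet> \<gamma>'' s\<close>. The tangent space of the tube domain
  is spanned by \<open>(0, e)\<close> and \<open>(1, - m T)\<close>. The differential of the tube map sends these vectors to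
  \<open>r e\<close> and \<open>(1 - r m) T\<close>, and that of \<open>v\<close>, the opposite of the normal, sends them to \<open>e\<close> and \<open>- m T\<close>.
  So the principal curvatures are \<open>1 / r\<close> and \<open>k = - m / (1 - r m)\<close>, and
  \<open>K r\<^sup>2 - 2 r H + 1 = (r / r - 1) (r k - 1) = 0\<close>. Regularity gives \<open>r m \<noteq> 1\<close>, because
  \<open>\<bar>m\<bar> \<le> \<kappa>\<close> makes \<open>m\<close> of the form \<open>\<kappa> cos t\<close>.\<close>

section \<open>Vector algebra, and derivatives along curves in a set\<close>

lemma orthonormal_cross_expansion:
  fixes x y z :: "real^3"
  assumes "norm x = 1" "norm y = 1" "x \<bullet> y = 0"
  shows "z = (z \<bullet> x) *\<^sub>R x + (z \<bullet> y) *\<^sub>R y + (z \<bullet> cross3 x y) *\<^sub>R cross3 x y"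
proof -
  let ?e = "cross3 x y"
  define d where "d = z - ((z \<bullet> x) *\<^sub>R x + (z \<bullet> y) *\<^sub>R y + (z \<bullet> ?e) *\<^sub>R ?e)"
  have ne: "norm ?e ^ 2 = 1"
    using norm_cross_dot[of x y] assms by simp
  have ee: "?e \<bullet> ?e = 1" using ne by (simp add: power2_norm_eq_inner)
  have xx: "x \<bullet> x = 1" "y \<bullet> y = 1" "y \<bullet> x = 0"
    using assms by (simp_all add: norm_eq_1 inner_commute)
  have d: "d \<bullet> x = 0" "d \<bullet> y = 0" "d \<bullet> ?e = 0"
    using xx assms(3) ee
    by (simp_all add: d_def inner_diff_left inner_add_left dot_cross_self)
  \<comment> \<open>By Lagrange's identity \<open>cross3 d ?e\<close> is a combination of
    \<open>x\<close> and \<open>y\<close> with coefficients \<open>d \<bullet> y\<close> and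
    \<open>- (d \<bullet> x)\<close>. Being both parallel and orthogonal to the nonzero
    \<open>?e\<close>, the remainder \<open>d\<close> vanishes.\<close>
  have "cross3 d ?e = 0" using d by (simp add: Lagrange)
  with d(3) have "d = 0 \<or> ?e = 0" using norm_and_cross_eq_0[of d ?e] by simp
  with ee have "d = 0" by auto
  then show ?thesis by (simp add: d_def)
qed

lemma in_span_pair_iff:
  fixes x u w :: "'a::real_vector"
  shows "x \<in> span {u, w} \<longleftrightarrow> (\<exists>k l. x = k *\<^sub>R u + l *\<^sub>R w)"
  by (simp add: span_breakdown_eq[of x u] span_singleton image_iff diff_eq_eq add.commute)

text \<open>Only a neighbourhood of 0 is mapped into \<open>M\<close>, so the chain rule is applied
  to the restriction of \<open>c\<close> to such a neighbourhood.\<close>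

lemma has_vector_derivative_along_tangent:
  assumes f: "(f has_derivative f') (at (c 0) within M)"
    and ev: "\<forall>\<^sub>F \<tau> in nhds 0. c \<tau> \<in> M" and c: "(c has_vector_derivative w) (at (0::real))"
  shows "((f \<circ> c) has_vector_derivative f' w) (at 0)"
proof -
  obtain S where S: "open S" "0 \<in> S" "\<forall>\<tau>\<in>S. c \<tau> \<in> M"
    using ev unfolding eventually_nhds by blast
  have f_image: "(f has_derivative f') (at (c 0) within c ` S)"
    using f by (rule has_derivative_subset) (use S in blast)
  have "((f \<circ> c) has_vector_derivative f' w) (at 0 within S)"
    by (rule vector_derivative_diff_chain_within[OF has_vector_derivative_at_within[OF c] f_image])
  then show ?thesis using S by (simp only: at_within_open)
qed

text \<open>Both values are the derivative at 0 of \<open>f\<close> along one curve in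
  \<open>M\<close> with velocity \<open>w\<close>. Hence the unspecified \<open>f'\<close> and
  \<open>N'\<close> in \<open>principal_curvatures\<close> can be replaced by explicit
  derivatives.\<close>

lemma has_derivative_unique_on_tangent_space:
  assumes "(f has_derivative f1) (at p within M)" "(f has_derivative f2) (at p within M)"
    and "w \<in> tangent_space M p"
  shows "f1 w = f2 w"
proof -
  from assms(3) obtain c where c: "c 0 = p" "\<forall>\<^sub>F \<tau> in nhds 0. c \<tau> \<in> M"
      "(c has_vector_derivative w) (at 0)"
    by (auto simp: tangent_space_def)
  note along = has_vector_derivative_along_tangent[OF _ c(2,3), unfolded c(1)]
  show ?thesis
    by (rule vector_derivative_unique_at[OF along[OF assms(1)] along[OF assms(2)]])
qed

text \<open>Serves to differentiate the equations that define \<open>tube_domain\<close> along a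
  curve that is known to lie in it only near 0.\<close>

lemma has_vector_derivative_eventually_const:
  assumes "(f has_vector_derivative d) (at t)" "\<forall>\<^sub>F x in nhds t. f x = a"
  shows "d = 0"
proof -
  have "(f has_vector_derivative d) (at t) \<longleftrightarrow> ((\<lambda>_. a) has_vector_derivative d) (at t)"
    using assms(2) by (intro has_vector_derivative_cong_ev) (auto dest: eventually_nhds_x_imp_x)
  with assms(1) have "((\<lambda>_. a) has_vector_derivative d) (at t)" by simp
  then show ?thesis using has_vector_derivative_const by (rule vector_derivative_unique_at)
qed

text \<open>A velocity orthogonal to the unit vector \<open>q t\<close> leaves the norm stationary,
  so dividing by the norm does not change the derivative.\<close>

lemma has_vector_derivative_normalize:
  fixes q :: "real \<Rightarrow> 'a::real_inner"
  assumes "(q has_vector_derivative d) (at t)" "norm (q t) = 1" "q t \<bullet> d = 0"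
  shows "((\<lambda>x. q x /\<^sub>R norm (q x)) has_vector_derivative d) (at t)"
proof -
  have "q t \<noteq> 0" using assms(2) by auto
  then have "((\<lambda>x. norm (q x)) has_derivative (\<lambda>h. (h *\<^sub>R d) \<bullet> sgn (q t))) (at t)"
    using has_derivative_compose[OF assms(1)[unfolded has_vector_derivative_def]
        has_derivative_norm] by (simp add: comp_def inner_commute)
  moreover have "(\<lambda>h. (h *\<^sub>R d) \<bullet> sgn (q t)) = (*) 0"
    using assms(2,3) by (simp add: sgn_div_norm inner_commute fun_eq_iff)
  ultimately have "((\<lambda>x. norm (q x)) has_field_derivative 0) (at t)"
    by (simp only: has_field_derivative_def)
  then have "((\<lambda>x. inverse (norm (q x))) has_field_derivative 0) (at t)"
    using DERIV_inverse_fun[of "\<lambda>x. norm (q x)" 0 t UNIV] assms(2) by simp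
  from has_vector_derivative_scaleR[OF this assms(1)] show ?thesis
    using assms(2) by simp
qed

section \<open>The orthonormal frame at a point of the tube\<close>

text \<open>The vector \<open>n\<close> stands for the second derivative of the central curve at
  \<open>s\<close>; \<open>immersive\<close> is what regularity says in the single direction
  \<open>v\<close>.\<close>

locale regular_tube_point =
  fixes I :: "real set" and \<gamma> :: "real \<Rightarrow> real^3" and r s :: real and v n :: "real^3"
  assumes open_I: "open I"
    and s_in: "s \<in> I"
    and speed: "t \<in> I \<Longrightarrow> norm (curve_deriv \<gamma> t) = 1"
    and deriv1: "(\<gamma> has_vector_derivative curve_deriv \<gamma> s) (at s)"
    and deriv2: "(curve_deriv \<gamma> has_vector_derivative n) (at s)"
    and r_pos: "r > 0"
    and norm_v: "norm v = 1"
    and v_orth: "v \<bullet> curve_deriv \<gamma> s = 0"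
    and immersive: "r * (v \<bullet> n) \<noteq> 1"
begin

abbreviation "M \<equiv> tube_domain I \<gamma>"
abbreviation "T \<equiv> curve_deriv \<gamma> s"
abbreviation "e \<equiv> cross3 T v"
abbreviation "m \<equiv> v \<bullet> n"
abbreviation "k0 \<equiv> - m / (1 - r * m)"

lemma frame:
  "T \<bullet> T = 1" "v \<bullet> v = 1" "e \<bullet> e = 1" "T \<bullet> v = 0" "v \<bullet> T = 0"
  "T \<bullet> e = 0" "e \<bullet> T = 0" "v \<bullet> e = 0" "e \<bullet> v = 0"
proof -
  show T: "T \<bullet> T = 1" "v \<bullet> v = 1" "T \<bullet> v = 0" "v \<bullet> T = 0"
    using speed[OF s_in] norm_v v_orth by (simp_all add: norm_eq_1 inner_commute)
  show "T \<bullet> e = 0" "e \<bullet> T = 0" "v \<bullet> e = 0" "e \<bullet> v = 0"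
    by (simp_all add: dot_cross_self)
  have "norm e ^ 2 = 1"
    using norm_cross_dot[of T v] T speed[OF s_in] norm_v by simp
  then show "e \<bullet> e = 1" by (simp add: power2_norm_eq_inner)
qed

lemma frame_eq_iff: "a *\<^sub>R T + b *\<^sub>R e = c *\<^sub>R T + d *\<^sub>R e \<longleftrightarrow> a = c \<and> b = d"
proof
  assume h: "a *\<^sub>R T + b *\<^sub>R e = c *\<^sub>R T + d *\<^sub>R e"
  from arg_cong[OF h, of "\<lambda>x. x \<bullet> T"] arg_cong[OF h, of "\<lambda>x. x \<bullet> e"]
  show "a = c \<and> b = d" by (simp add: inner_add_left frame)
qed auto

section \<open>The tangent space of the tube domain\<close>

text \<open>Here \<alpha> is the speed along the central curve and \<beta> the speed of rotation of
  \<open>v\<close> about \<open>T\<close>. The component along \<open>T\<close> is forced: it keeps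
  \<open>v\<close> in the moving normal plane to first order.\<close>

definition tangent :: "real \<Rightarrow> real \<Rightarrow> real \<times> (real^3)" where
  "tangent \<alpha> \<beta> = (\<alpha>, (- \<alpha> * m) *\<^sub>R T + \<beta> *\<^sub>R e)"

text \<open>A curve with this velocity arises by moving the base point with speed \<alpha> and
  \<open>v\<close> linearly in direction \<open>\<beta> *\<^sub>R e\<close>, projecting to the
  normal plane of the central curve, and normalizing. The projection contributes the component along
  \<open>T\<close>.\<close>

lemma tangent_in: "tangent \<alpha> \<beta> \<in> tangent_space M (s, v)"
proof -
  define C where "C \<tau> = curve_deriv \<gamma> (s + \<alpha> * \<tau>)" for \<tau>
  define u where "u \<tau> = v + \<tau> *\<^sub>R (\<beta> *\<^sub>R e)" for \<tau>
  define q where "q \<tau> = u \<tau> - (u \<tau> \<bullet> C \<tau>) *\<^sub>R C \<tau>" for \<tau>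
  have q0: "q 0 = v" by (simp add: q_def u_def C_def frame)
  have line: "((\<lambda>\<tau>. s + \<alpha> * \<tau>) has_vector_derivative \<alpha>) (at 0)"
    by (auto intro!: derivative_eq_intros)
  have C': "(C has_vector_derivative \<alpha> *\<^sub>R n) (at 0)"
    using vector_diff_chain_at[OF line, of "curve_deriv \<gamma>" n] deriv2
    by (simp add: C_def[abs_def] comp_def)
  have u': "(u has_vector_derivative \<beta> *\<^sub>R e) (at 0)"
    unfolding u_def[abs_def] by (auto intro!: derivative_eq_intros)
  have uC': "((\<lambda>\<tau>. u \<tau> \<bullet> C \<tau>) has_vector_derivative \<alpha> * m) (at 0)"
    using bounded_bilinear.has_vector_derivative[OF bounded_bilinear_inner u' C']
    by (simp add: u_def C_def frame)
  have q': "(q has_vector_derivative snd (tangent \<alpha> \<beta>)) (at 0)"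
    unfolding q_def[abs_def]
    using has_vector_derivative_diff[OF u'
        bounded_bilinear.has_vector_derivative[OF bounded_bilinear_scaleR uC' C']]
    by (simp add: u_def C_def frame tangent_def)
  have \<nu>': "((\<lambda>\<tau>. q \<tau> /\<^sub>R norm (q \<tau>)) has_vector_derivative snd (tangent \<alpha> \<beta>)) (at 0)"
    using q' by (rule has_vector_derivative_normalize)
      (simp_all add: q0 norm_v tangent_def inner_add_right inner_diff_right frame)
  define c where "c \<tau> = (s + \<alpha> * \<tau>, q \<tau> /\<^sub>R norm (q \<tau>))" for \<tau>
  have c': "(c has_vector_derivative tangent \<alpha> \<beta>) (at 0)"
    using has_vector_derivative_Pair[OF line \<nu>'] by (simp add: c_def[abs_def] tangent_def)
  \<comment> \<open>Normalizing yields a unit vector only where \<open>q\<close> is nonzero;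
    continuity ensures this near 0.\<close>
  have "continuous (at 0) q" by (rule has_vector_derivative_continuous[OF q'])
  then have lim: "filterlim q (nhds v) (nhds 0)"
    using q0 tendsto_at_iff_tendsto_nhds[of q 0] by (simp add: continuous_at)
  have "\<forall>\<^sub>F x in nhds v. x \<noteq> 0"
    by (rule t1_space_nhds) (use norm_v in auto)
  from this lim have "\<forall>\<^sub>F \<tau> in nhds 0. q \<tau> \<noteq> 0"
    by (rule eventually_compose_filterlim)
  moreover have "\<forall>\<^sub>F \<tau> in nhds 0. s + \<alpha> * \<tau> \<in> I"
  proof -
    have "open ((\<lambda>\<tau>. s + \<alpha> * \<tau>) -` I)"
      by (intro open_vimage open_I continuous_intros)
    then show ?thesis using s_in by (auto simp: eventually_nhds)
  qed
  ultimately have "\<forall>\<^sub>F \<tau> in nhds 0. c \<tau> \<in> M"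
  proof eventually_elim
    case (elim \<tau>)
    have "C \<tau> \<bullet> C \<tau> = 1" using speed[OF elim(2)] by (simp add: C_def norm_eq_1)
    then have "q \<tau> \<bullet> C \<tau> = 0" by (simp add: q_def inner_diff_left)
    with elim show ?case by (simp add: c_def tube_domain_def C_def)
  qed
  with c' show ?thesis
    unfolding tangent_space_def by (auto simp: c_def q0 norm_v intro!: exI[of _ c])
qed

text \<open>Conversely, along a curve in \<open>M\<close> the derivatives of the two constraints,
  orthogonality to the central curve and unit length, fix the components of the velocity along
  \<open>T\<close> and \<open>v\<close>. Only the component along \<open>e\<close> stays
  free.\<close>

lemma tangent_space_tube: "tangent_space M (s, v) = range (\<lambda>(\<alpha>, \<beta>). tangent \<alpha> \<beta>)"
proof
  show "tangent_space M (s, v) \<subseteq> range (\<lambda>(\<alpha>, \<beta>). tangent \<alpha> \<beta>)"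
  proof
    fix w assume "w \<in> tangent_space M (s, v)"
    then obtain c where c: "c 0 = (s, v)" "\<forall>\<^sub>F \<tau> in nhds 0. c \<tau> \<in> M"
        "(c has_vector_derivative w) (at 0)"
      by (auto simp: tangent_space_def)
    obtain \<alpha> x where w: "w = (\<alpha>, x)" by fastforce
    have fst': "((\<lambda>\<tau>. fst (c \<tau>)) has_vector_derivative \<alpha>) (at 0)"
      using bounded_linear.has_vector_derivative[OF bounded_linear_fst c(3)] w by simp
    have snd': "((\<lambda>\<tau>. snd (c \<tau>)) has_vector_derivative x) (at 0)"
      using bounded_linear.has_vector_derivative[OF bounded_linear_snd c(3)] w by simp
    have C': "((\<lambda>\<tau>. curve_deriv \<gamma> (fst (c \<tau>))) has_vector_derivative \<alpha> *\<^sub>R n) (at 0)"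
      using vector_diff_chain_at[OF fst', of "curve_deriv \<gamma>" n] deriv2 c(1)
      by (simp add: comp_def)
    have "((\<lambda>\<tau>. snd (c \<tau>) \<bullet> curve_deriv \<gamma> (fst (c \<tau>))) has_vector_derivative
        v \<bullet> (\<alpha> *\<^sub>R n) + x \<bullet> T) (at 0)"
      using bounded_bilinear.has_vector_derivative[OF bounded_bilinear_inner snd' C'] c(1) by simp
    moreover have "\<forall>\<^sub>F \<tau> in nhds 0. snd (c \<tau>) \<bullet> curve_deriv \<gamma> (fst (c \<tau>)) = 0"
      using c(2) by eventually_elim (auto simp: tube_domain_def)
    ultimately have "v \<bullet> (\<alpha> *\<^sub>R n) + x \<bullet> T = 0"
      by (rule has_vector_derivative_eventually_const)
    then have xT: "x \<bullet> T = - \<alpha> * m" by simp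
    have "((\<lambda>\<tau>. snd (c \<tau>) \<bullet> snd (c \<tau>)) has_vector_derivative v \<bullet> x + x \<bullet> v) (at 0)"
      using bounded_bilinear.has_vector_derivative[OF bounded_bilinear_inner snd' snd'] c(1) by simp
    moreover have "\<forall>\<^sub>F \<tau> in nhds 0. snd (c \<tau>) \<bullet> snd (c \<tau>) = 1"
      using c(2) by eventually_elim (auto simp: tube_domain_def norm_eq_1)
    ultimately have "v \<bullet> x + x \<bullet> v = 0"
      by (rule has_vector_derivative_eventually_const)
    then have xv: "x \<bullet> v = 0" by (simp add: inner_commute)
    have "x = (- \<alpha> * m) *\<^sub>R T + (x \<bullet> e) *\<^sub>R e"
      using orthonormal_cross_expansion[OF speed[OF s_in] norm_v frame(4), of x] xT xv by simp
    then have "w = tangent \<alpha> (x \<bullet> e)" by (simp add: w tangent_def)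
    then show "w \<in> range (\<lambda>(\<alpha>, \<beta>). tangent \<alpha> \<beta>)" by auto
  qed
qed (auto simp: tangent_in)

section \<open>The differentials of the tube map and of the normal\<close>

lemma tube_map_derivative:
  "(tube_map \<gamma> r has_derivative (\<lambda>(\<alpha>, x). \<alpha> *\<^sub>R T + r *\<^sub>R x)) (at (s, v) within S)"
proof -
  have "((\<lambda>p. \<gamma> (fst p)) has_derivative (\<lambda>h. fst h *\<^sub>R T)) (at (s, v) within S)"
    using has_derivative_compose[OF has_derivative_fst[OF has_derivative_ident],
        of \<gamma> "\<lambda>h. h *\<^sub>R T" "(s, v)" S] deriv1
    by (simp add: has_vector_derivative_def)
  then have "((\<lambda>p. \<gamma> (fst p) + r *\<^sub>R snd p) has_derivative (\<lambda>h. fst h *\<^sub>R T + r *\<^sub>R snd h))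
      (at (s, v) within S)"
    by (intro derivative_intros)
  then show ?thesis by (simp add: tube_map_def case_prod_unfold)
qed

lemma tube_normal_derivative:
  "(tube_normal has_derivative (\<lambda>(\<alpha>, x). - x)) (at p within S)"
  unfolding tube_normal_def case_prod_unfold by (intro derivative_intros)

lemma tube_map_tangent:
  "(\<lambda>(\<alpha>, x). \<alpha> *\<^sub>R T + r *\<^sub>R x) (tangent \<alpha> \<beta>) = (\<alpha> * (1 - r * m)) *\<^sub>R T + (r * \<beta>) *\<^sub>R e"
  by (simp add: tangent_def algebra_simps)

text \<open>The left side is the eigenvector equation \<open>- N' w = k *\<^sub>R f' w\<close> for
  \<open>w = tangent \<alpha> \<beta>\<close>. Comparing components along \<open>T\<close> and
  \<open>e\<close> shows that the shape operator is diagonal, with entries \<open>k0\<close> and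
  \<open>1 / r\<close>.\<close>

lemma principal_direction_iff:
  "snd (tangent \<alpha> \<beta>) = k *\<^sub>R ((\<alpha> * (1 - r * m)) *\<^sub>R T + (r * \<beta>) *\<^sub>R e) \<longleftrightarrow>
    (\<alpha> = 0 \<or> k = k0) \<and> (\<beta> = 0 \<or> k = 1 / r)"
proof -
  have "snd (tangent \<alpha> \<beta>) = k *\<^sub>R ((\<alpha> * (1 - r * m)) *\<^sub>R T + (r * \<beta>) *\<^sub>R e) \<longleftrightarrow>
      - \<alpha> * m = k * (\<alpha> * (1 - r * m)) \<and> \<beta> = k * (r * \<beta>)"
    unfolding tangent_def snd_conv scaleR_add_right scaleR_scaleR frame_eq_iff ..
  moreover have "- \<alpha> * m = k * (\<alpha> * (1 - r * m)) \<longleftrightarrow> \<alpha> = 0 \<or> k = k0"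
  proof -
    have "- \<alpha> * m = k * (\<alpha> * (1 - r * m)) \<longleftrightarrow> \<alpha> * (k * (1 - r * m) + m) = 0"
      by (auto simp: algebra_simps)
    moreover have "k = k0 \<longleftrightarrow> k * (1 - r * m) + m = 0"
      using immersive
      by (simp add: nonzero_eq_divide_eq eq_neg_iff_add_eq_0 del: minus_divide_left divide_minus_left)
    ultimately show ?thesis by simp
  qed
  moreover have "\<beta> = k * (r * \<beta>) \<longleftrightarrow> \<beta> = 0 \<or> k = 1 / r"
    using r_pos by (auto simp: field_simps)
  ultimately show ?thesis by simp
qed

section \<open>The principal curvatures\<close>

lemma principal_curvatures_tube: "principal_curvatures M (tube_map \<gamma> r) tube_normal (s, v) (1 / r) k0"
proof -
  let ?f' = "\<lambda>(\<alpha>, x). \<alpha> *\<^sub>R T + r *\<^sub>R x" and ?N' = "\<lambda>(\<alpha>, x). - x"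
  \<comment> \<open>The eigenvectors: \<open>?w1\<close> rotates \<open>v\<close> along the circle
    of radius \<open>r\<close>, and \<open>?w2\<close> moves along the central curve without
    rotation about \<open>T\<close>.\<close>
  let ?w1 = "tangent 0 1" and ?w2 = "tangent 1 0"
  have comb: "\<beta> *\<^sub>R ?w1 + \<alpha> *\<^sub>R ?w2 = tangent \<alpha> \<beta>" for \<alpha> \<beta>
    by (simp add: tangent_def algebra_simps)
  have e0: "e \<noteq> 0" using frame by auto
  have "?w1 \<noteq> ?w2" by (simp add: tangent_def)
  moreover have "independent {?w1, ?w2}"
    using e0 by (auto simp: independent_insert span_singleton tangent_def prod_eq_iff)
  moreover have "tangent_space M (s, v) = span {?w1, ?w2}"
    unfolding tangent_space_tube
    by (auto simp: set_eq_iff in_span_pair_iff image_iff comb)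
  moreover have "inj_on ?f' (tangent_space M (s, v))"
    unfolding tangent_space_tube inj_on_def
    using immersive r_pos by (auto simp del: case_prod_conv simp: tube_map_tangent frame_eq_iff)
  moreover have "norm (tube_normal (s, v)) = 1" by (simp add: tube_normal_def norm_v)
  moreover have "\<forall>w\<in>tangent_space M (s, v). tube_normal (s, v) \<bullet> ?f' w = 0"
    unfolding tangent_space_tube
    by (auto simp: tube_normal_def tangent_def inner_add_right inner_diff_right frame)
  moreover have "- ?N' ?w1 = (1 / r) *\<^sub>R ?f' ?w1" "- ?N' ?w2 = k0 *\<^sub>R ?f' ?w2"
    using principal_direction_iff[of 0 1 "1 / r"] principal_direction_iff[of 1 0 k0]
    unfolding tube_map_tangent by (simp_all add: case_prod_unfold)
  ultimately show ?thesis
    unfolding principal_curvatures_def using tube_map_derivative tube_normal_derivative by blast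
qed

text \<open>Needed for the definite descriptions of the curvatures, which admit any basis of
  eigenvectors. A nonzero coordinate of an eigenvector determines its eigenvalue, and independence
  makes each coordinate nonzero in at least one of the two.\<close>

lemma principal_curvatures_tube_unique:
  assumes "principal_curvatures M (tube_map \<gamma> r) tube_normal (s, v) k1 k2"
  shows "k1 = 1 / r \<and> k2 = k0 \<or> k1 = k0 \<and> k2 = 1 / r"
proof -
  from assms obtain f' N' w1 w2 where
    f': "(tube_map \<gamma> r has_derivative f') (at (s, v) within M)" and
    N': "(tube_normal has_derivative N') (at (s, v) within M)" and
    w: "w1 \<noteq> w2" "independent {w1, w2}" "tangent_space M (s, v) = span {w1, w2}" and
    k: "- N' w1 = k1 *\<^sub>R f' w1" "- N' w2 = k2 *\<^sub>R f' w2"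
    unfolding principal_curvatures_def by blast
  have mem: "w1 \<in> tangent_space M (s, v)" "w2 \<in> tangent_space M (s, v)"
    unfolding w(3) by (simp_all add: span_base)
  then obtain \<alpha>1 \<beta>1 \<alpha>2 \<beta>2 where ab: "w1 = tangent \<alpha>1 \<beta>1" "w2 = tangent \<alpha>2 \<beta>2"
    unfolding tangent_space_tube by auto
  have f'_eq: "f' (tangent \<alpha> \<beta>) = (\<alpha> * (1 - r * m)) *\<^sub>R T + (r * \<beta>) *\<^sub>R e" for \<alpha> \<beta>
    using has_derivative_unique_on_tangent_space[OF f' tube_map_derivative tangent_in]
    unfolding tube_map_tangent .
  have N'_eq: "N' (tangent \<alpha> \<beta>) = - snd (tangent \<alpha> \<beta>)" for \<alpha> \<beta>
    using has_derivative_unique_on_tangent_space[OF N' tube_normal_derivative tangent_in]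
    by (simp add: case_prod_unfold)
  have 1: "(\<alpha>1 = 0 \<or> k1 = k0) \<and> (\<beta>1 = 0 \<or> k1 = 1 / r)"
    and 2: "(\<alpha>2 = 0 \<or> k2 = k0) \<and> (\<beta>2 = 0 \<or> k2 = 1 / r)"
    using k unfolding ab f'_eq N'_eq minus_minus principal_direction_iff by auto
  have dep: "\<not> (c *\<^sub>R w1 + d *\<^sub>R w2 = 0 \<and> (c, d) \<noteq> (0, 0))" for c d
  proof -
    let ?u = "\<lambda>w. if w = w1 then c else d"
    have "c *\<^sub>R w1 + d *\<^sub>R w2 = (\<Sum>w\<in>{w1, w2}. ?u w *\<^sub>R w)" using w(1) by simp
    moreover have "?u w1 = 0 \<and> ?u w2 = 0" if "(\<Sum>w\<in>{w1, w2}. ?u w *\<^sub>R w) = 0"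
      using independentD[OF w(2) _ _ that] by blast
    ultimately show ?thesis using w(1) by auto
  qed
  \<comment> \<open>With \<alpha>1 and \<alpha>2 zero, both vectors are multiples of
    \<open>(0, e)\<close>, and \<open>\<beta>2\<close>, \<open>- \<beta>1\<close> are the
    coefficients of a relation. If these vanish too, then already \<open>w1 = 0\<close>.\<close>
  have "\<not> (\<alpha>1 = 0 \<and> \<alpha>2 = 0)"
    using dep[of \<beta>2 "- \<beta>1"] dep[of 1 0] by (auto simp: ab tangent_def prod_eq_iff)
  moreover have "\<not> (\<beta>1 = 0 \<and> \<beta>2 = 0)"
    using dep[of \<alpha>2 "- \<alpha>1"] dep[of 1 0] by (auto simp: ab tangent_def prod_eq_iff)
  \<comment> \<open>The zero vector is excluded, as it would satisfy the eigenvector equation for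
    every \<open>k\<close>.\<close>
  moreover have "\<not> (\<alpha>1 = 0 \<and> \<beta>1 = 0)" "\<not> (\<alpha>2 = 0 \<and> \<beta>2 = 0)"
    using dep[of 1 0] dep[of 0 1] by (auto simp: ab tangent_def prod_eq_iff)
  ultimately show ?thesis using 1 2 by blast
qed

section \<open>Gaussian and mean curvature, and their relation\<close>

lemma gauss_curvature_tube: "gauss_curvature M (tube_map \<gamma> r) tube_normal (s, v) = k0 / r"
  unfolding gauss_curvature_def
proof (rule the_equality)
  show "\<exists>k1 k2. principal_curvatures M (tube_map \<gamma> r) tube_normal (s, v) k1 k2 \<and> k0 / r = k1 * k2"
    using principal_curvatures_tube by (intro exI conjI) auto
qed (auto dest!: principal_curvatures_tube_unique)

lemma mean_curvature_tube: "mean_curvature M (tube_map \<gamma> r) tube_normal (s, v) = (1 / r + k0) / 2"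
  unfolding mean_curvature_def
proof (rule the_equality)
  show "\<exists>k1 k2. principal_curvatures M (tube_map \<gamma> r) tube_normal (s, v) k1 k2
      \<and> (1 / r + k0) / 2 = (k1 + k2) / 2"
    using principal_curvatures_tube by blast
qed (auto dest!: principal_curvatures_tube_unique)

lemma weingarten_tube:
  "gauss_curvature M (tube_map \<gamma> r) tube_normal (s, v) * r\<^sup>2
    - 2 * r * mean_curvature M (tube_map \<gamma> r) tube_normal (s, v) + 1 = 0"
proof -
  \<comment> \<open>Since one principal curvature is \<open>1 / r\<close>, the terms in the other
    one cancel, whatever its value \<open>k\<close>.\<close>
  have "k / r * r\<^sup>2 - 2 * r * ((1 / r + k) / 2) + 1 = 0" for k
    using r_pos by (simp add: field_simps power2_eq_square)
  then show ?thesis unfolding gauss_curvature_tube mean_curvature_tube .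
qed

end

section \<open>From regularity to the pointwise assumptions\<close>

text \<open>Links the cosine in \<open>regular_tube\<close> to inner products with unit vectors: the
  angle is the arc cosine of \<open>x / k\<close>, while \<open>k = 0\<close> forces
  \<open>x = 0\<close>.\<close>

lemma abs_le_imp_eq_mult_cos:
  fixes x k :: real
  assumes "\<bar>x\<bar> \<le> k"
  obtains t where "x = k * cos t"
proof (cases "k = 0")
  case False
  with assms have "k > 0" "-1 \<le> x / k" "x / k \<le> 1" by (auto simp: field_simps)
  then have "x = k * cos (arccos (x / k))" by simp
  then show ?thesis by (rule that)
qed (use assms that in auto)

lemma regular_tube_pointI:
  assumes "open I" and smooth: "smooth_curve_on I \<gamma>" and "r > 0" and reg: "regular_tube I \<gamma> r"
    and p: "(s, v) \<in> tube_domain I \<gamma>"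
  shows "regular_tube_point I \<gamma> r s v (curve_deriv (curve_deriv \<gamma>) s)"
proof -
  let ?n = "curve_deriv (curve_deriv \<gamma>) s"
  have s: "s \<in> I" "norm v = 1" "v \<bullet> curve_deriv \<gamma> s = 0"
    using p by (auto simp: tube_domain_def)
  \<comment> \<open>Orders 0 and 1 of smoothness give the first and second derivatives of the
    central curve.\<close>
  have "(curve_deriv ^^ 0) \<gamma> differentiable (at s)" "(curve_deriv ^^ 1) \<gamma> differentiable (at s)"
    using smooth s(1) unfolding smooth_curve_on_def by blast+
  then have d: "(\<gamma> has_vector_derivative curve_deriv \<gamma> s) (at s)"
      "(curve_deriv \<gamma> has_vector_derivative ?n) (at s)"
    by (simp_all add: curve_deriv_def[abs_def] vector_derivative_works)
  have "\<bar>v \<bullet> ?n\<bar> \<le> norm ?n" using Cauchy_Schwarz_ineq2[of v ?n] s(2) by simp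
  then obtain t where "v \<bullet> ?n = norm ?n * cos t" by (rule abs_le_imp_eq_mult_cos)
  moreover have "1 - r * norm ?n * cos t \<noteq> 0" using reg s(1) by (auto simp: regular_tube_def)
  ultimately have "r * (v \<bullet> ?n) \<noteq> 1" by (simp add: mult.assoc)
  with assms s d reg show ?thesis
    by unfold_locales (auto simp: regular_tube_def)
qed

theorem corollary4:
  fixes \<gamma> :: "real \<Rightarrow> real^3" and a b :: ereal and r :: real
  assumes "a < b"
    and "smooth_curve_on (einterval a b) \<gamma>"
    and "\<forall>s\<in>einterval a b. curve_deriv \<gamma> s \<noteq> 0"
    and "r > 0"
    and "regular_tube (einterval a b) \<gamma> r"
  shows "linear_weingarten (tube_domain (einterval a b) \<gamma>) (tube_map \<gamma> r) tube_normal
    \<and> (\<forall>p\<in>tube_domain (einterval a b) \<gamma>.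
         gauss_curvature (tube_domain (einterval a b) \<gamma>) (tube_map \<gamma> r) tube_normal p * r\<^sup>2
         - 2 * r * mean_curvature (tube_domain (einterval a b) \<gamma>) (tube_map \<gamma> r) tube_normal p
         + 1 = 0)"
proof -
  let ?M = "tube_domain (einterval a b) \<gamma>"
  let ?K = "gauss_curvature ?M (tube_map \<gamma> r) tube_normal"
  let ?H = "mean_curvature ?M (tube_map \<gamma> r) tube_normal"
  have rel: "?K p * r\<^sup>2 - 2 * r * ?H p + 1 = 0" if "p \<in> ?M" for p
    using regular_tube_point.weingarten_tube[OF regular_tube_pointI[OF _ assms(2,4,5)]] that
    by (cases p) simp
  have "r\<^sup>2 * ?K p + (- 2 * r) * ?H p + 1 = 0" if "p \<in> ?M" for p
    using rel[OF that] by (simp add: mult.commute)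
  moreover have "(r\<^sup>2, - 2 * r) \<noteq> (0, 0)" using \<open>r > 0\<close> by simp
  ultimately have "linear_weingarten ?M (tube_map \<gamma> r) tube_normal"
    unfolding linear_weingarten_def by blast
  with rel show ?thesis by blast
qed

end
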